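(* Let $f$ be a probability mass function with discrete support $\mathbb{T}\subseteq\mathbb{R}$, let $X_1,X_2,\ldots$ be i.i.d. discrete random variables with probability mass function $f$, let $(h_n)_{n\ge 1}$ be a sequence of positive numbers with $\lim_{n\to\infty}h_n=0$, and let $\{K_{x,h}:x\in\mathbb{T},h>0\}$ be a family of kernels, where $K_{x,h}$ is the probability mass function of a discrete random variable $Z_{x,h}$ on a discrete set $\mathbb{S}_x\subseteq\mathbb{R}$. Assume that, as $n\to\infty$, $$x\in\mathbb{S}_x\ \text{ for every } x\in\mathbb{T},\qquad \sup_{x\in\mathbb{T}}\left|\mathbb{E}(Z_{x,h_n})-x\right|=\mathcal{O}(h_n),\qquad \sup_{x\in\mathbb{T}}\mathrm{Var}(Z_{x,h_n})=\mathcal{O}(h_n).$$ If the sequence $(h_n)_{n\ge1}$ is chosen such that $\sqrt{n}\,h_n\to0$ as $n\to\infty$, then, for any $x\in\mathbb{T}$ such that $f(x)>0$, the sequence $\{\sqrt{n}(\widehat{f}_n(x)-f(x))\}_{n\ge1}$, where $\widehat{f}_n(x)=\widetilde{f}_n(x)/C_n$, converges in distribution to the centered normal distribution with variance $f(x)\{1-f(x)\}$.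
   Context: The support $\mathbb{T}$ may be bounded or unbounded, finite or infinite. Each $K_{x,h}$ is a probability mass function on $\mathbb{S}_x$, with $K_{x,h}(z)=0$ for $z\notin\mathbb{S}_x$. The non-normalized estimator and the normalizing random variable are $$\widetilde{f}_n(x)=\frac1n\sum_{i=1}^nK_{x,h_n}(X_i)\quad(x\in\mathbb{T}),\qquad C_n=\sum_{x\in\mathbb{T}}\widetilde{f}_n(x),$$ and it is a standing assumption that $C_n>0$.
   Formalization: The statement fails for some infinite supports with only pointwise gaps; it is proved assuming one δ>0 such that every point of 𝕋 ∪ 𝕊_x other than x lies at distance at least δ from x, for all x in 𝕋 (automatic if 𝕋 is finite or if 𝕋 and all 𝕊_x consist of integers). *)

theory Defs
  imports "HOL-Probability.Probability" "HOL-Library.Landau_Symbols"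
begin

text \<open>
  A kernel family is a function \<open>K :: real \<Rightarrow> real \<Rightarrow> real pmf\<close>: the value \<open>K x h\<close> is the law of
  \<open>Z\<^sub>x\<^sub>,\<^sub>h\<close>, and \<open>pmf (K x h) z\<close> is its probability mass at \<open>z\<close>. Samples are indexed from 1.
\<close>

definition kernel_estimator ::
  "(real \<Rightarrow> real \<Rightarrow> real pmf) \<Rightarrow> (nat \<Rightarrow> real) \<Rightarrow> (nat \<Rightarrow> 'w \<Rightarrow> real) \<Rightarrow> nat \<Rightarrow> real \<Rightarrow> 'w \<Rightarrow> real" where
  "kernel_estimator K h X n x \<omega> = (\<Sum>i=1..n. pmf (K x (h n)) (X i \<omega>)) / real n"

text \<open>
  The sum over the support may be infinite. The value of \<open>infsum\<close> is 0 when the series diverges, so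
  positivity of this constant includes its finiteness.
\<close>

definition normalizing_constant ::
  "real set \<Rightarrow> (real \<Rightarrow> real \<Rightarrow> real pmf) \<Rightarrow> (nat \<Rightarrow> real) \<Rightarrow> (nat \<Rightarrow> 'w \<Rightarrow> real) \<Rightarrow> nat \<Rightarrow> 'w \<Rightarrow> real" where
  "normalizing_constant T K h X n \<omega> = (\<Sum>\<^sub>\<infinity>x\<in>T. kernel_estimator K h X n x \<omega>)"

definition normalized_estimator ::
  "real set \<Rightarrow> (real \<Rightarrow> real \<Rightarrow> real pmf) \<Rightarrow> (nat \<Rightarrow> real) \<Rightarrow> (nat \<Rightarrow> 'w \<Rightarrow> real) \<Rightarrow> nat \<Rightarrow> real \<Rightarrow> 'w \<Rightarrow> real" where
  "normalized_estimator T K h X n x \<omega> =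
     kernel_estimator K h X n x \<omega> / normalizing_constant T K h X n \<omega>"

text \<open>
  \<open>sup\<^sub>x\<^sub>\<in>\<^sub>T g x n = O(h n)\<close> as \<open>n \<rightarrow> \<infinity>\<close>. A supremum of reals has its intended meaning only for a set
  bounded above, hence the first conjunct.
\<close>

definition sup_bigo :: "real set \<Rightarrow> (real \<Rightarrow> nat \<Rightarrow> real) \<Rightarrow> (nat \<Rightarrow> real) \<Rightarrow> bool" where
  "sup_bigo T g h \<longleftrightarrow>
     (\<forall>\<^sub>F n in sequentially. bdd_above ((\<lambda>x. g x n) ` T)) \<and> (\<lambda>n. SUP x\<in>T. g x n) \<in> O(h)"

text \<open>
  Discreteness of \<open>T\<close> and of every \<open>S x\<close> isolates each \<open>x \<in> T\<close> in \<open>T \<union> S x\<close> by some gap depending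
  on \<open>x\<close>; here the gap is uniform in \<open>x\<close>. This is automatic if \<open>T\<close> is finite, and if \<open>T\<close> and all
  \<open>S x\<close> consist of integers. For infinite \<open>T\<close> pointwise gaps do not suffice for asymptotic
  normality of the normalized estimator. For \<open>T = {sqrt k | k}\<close> give \<open>K x h\<close>, \<open>1 \<le> x \<le> R h\<close>, mass
  \<open>min 1 (h / x\<^sup>2)\<close> at 0 and the remaining mass at \<open>x\<close>, and let \<open>K x h\<close> be the point mass at \<open>x\<close>
  otherwise. The moment conditions hold for every \<open>R\<close>, but since \<open>\<Sum>x\<in>T - {0}. 1 / x\<^sup>2\<close> diverges,
  a suitable \<open>R\<close> makes the normalizing constant tend to \<open>1 + f 0\<close>.
\<close>

definition uniformly_isolated :: "real set \<Rightarrow> (real \<Rightarrow> real set) \<Rightarrow> bool" where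
  "uniformly_isolated T S \<longleftrightarrow> (\<exists>\<delta>>0. \<forall>x\<in>T. \<forall>y\<in>T \<union> S x. y \<noteq> x \<longrightarrow> \<delta> \<le> \<bar>y - x\<bar>)"

text \<open>
  The normal law with mean \<open>\<mu>\<close> and variance \<open>v\<close>. For \<open>v = 0\<close> it is the point mass at \<open>\<mu>\<close>, whereas
  \<open>normal_density \<mu> 0\<close> is identically 0.
\<close>

definition normal_law :: "real \<Rightarrow> real \<Rightarrow> real measure" where
  "normal_law \<mu> v =
     (if v = 0 then return borel \<mu> else density lborel (\<lambda>x. ennreal (normal_density \<mu> (sqrt v) x)))"

end

theory Submission
  imports Defs
begin

text \<open>
  By Chebyshev's inequality \<open>pmf (K y (h n)) u\<close> is at most \<open>C * h n / (y - u)\<^sup>2\<close> for \<open>u \<noteq> y\<close>, and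
  \<open>pmf (K u (h n)) u\<close> differs from 1 by at most \<open>C * h n\<close> since \<open>S u\<close> has a gap around \<open>u\<close>.
  The points of \<open>T\<close> are uniformly separated, so \<open>\<Sum>y\<in>T - {u}. 1 / (y - u)\<^sup>2\<close> is bounded uniformly
  in \<open>u\<close>. Hence the normalizing constant is within \<open>O(h n)\<close> of 1, and the normalized estimator is
  almost surely within a deterministic \<open>O(h n)\<close> of the empirical frequency of \<open>x\<close>. After scaling by
  \<open>sqrt n\<close> this error still vanishes, so the limit is that of the empirical frequency, given by the
  central limit theorem for Bernoulli variables.
\<close>

section \<open>Weak convergence through characteristic functions; normal laws\<close>

lemma iexp_lipschitz: "cmod (iexp a - iexp b) \<le> \<bar>a - b\<bar>"
proof -
  have "iexp a - iexp b = iexp b * (iexp (a - b) - 1)"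
    by (simp add: algebra_simps flip: exp_add)
  then have "cmod (iexp a - iexp b) = cmod (iexp (a - b) - 1)"
    by (simp add: norm_mult)
  also have "\<dots> \<le> \<bar>a - b\<bar>"
    using iexp_approx1[of "a - b" 0] by simp
  finally show ?thesis .
qed

text \<open>Since \<open>iexp\<close> is 1-Lipschitz, the characteristic functions of
  \<open>Z n\<close> and \<open>Y n\<close> at \<open>t\<close> differ by at most
  \<open>\<bar>t\<bar> * \<epsilon> n\<close>, so Levy's continuity theorem transfers the limit. An
  almost sure bound for all large \<open>n\<close> suffices for this.\<close>

lemma (in prob_space) weak_conv_m_close:
  assumes [measurable]: "\<And>n. Y n \<in> borel_measurable M" "\<And>n. Z n \<in> borel_measurable M"
    and \<mu>: "real_distribution \<mu>"
    and conv: "weak_conv_m (\<lambda>n. distr M borel (Y n)) \<mu>"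
    and close: "\<forall>\<^sub>F n in sequentially. AE \<omega> in M. \<bar>Z n \<omega> - Y n \<omega>\<bar> \<le> \<epsilon> n"
    and \<epsilon>: "\<epsilon> \<longlonglongrightarrow> (0::real)"
  shows "weak_conv_m (\<lambda>n. distr M borel (Z n)) \<mu>"
proof (rule levy_continuity)
  show "real_distribution (distr M borel (Z n))" for n
    by (rule real_distribution_distr) simp
  show "real_distribution \<mu>" by fact
  fix t
  have Y: "(\<lambda>n. char (distr M borel (Y n)) t) \<longlonglongrightarrow> char \<mu> t"
    by (rule levy_continuity1) (auto intro: real_distribution_distr \<mu> conv)
  have "\<forall>\<^sub>F n in sequentially.
          cmod (char (distr M borel (Z n)) t - char (distr M borel (Y n)) t) \<le> \<bar>t\<bar> * \<epsilon> n"
    using close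
  proof eventually_elim
    case (elim n)
    have "cmod (char (distr M borel (Z n)) t - char (distr M borel (Y n)) t)
        = cmod (expectation (\<lambda>\<omega>. iexp (t * Z n \<omega>) - iexp (t * Y n \<omega>)))"
      by (subst Bochner_Integration.integral_diff)
         (auto simp: char_def integral_distr intro!: integrable_iexp)
    also have "\<dots> \<le> expectation (\<lambda>\<omega>. cmod (iexp (t * Z n \<omega>) - iexp (t * Y n \<omega>)))"
      by (rule integral_norm_bound)
    also have "\<dots> \<le> expectation (\<lambda>\<omega>. \<bar>t\<bar> * \<epsilon> n)"
    proof (rule integral_mono_AE)
      show "AE \<omega> in M. cmod (iexp (t * Z n \<omega>) - iexp (t * Y n \<omega>)) \<le> \<bar>t\<bar> * \<epsilon> n"
        using elim
      proof eventually_elim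
        case (elim \<omega>)
        have "cmod (iexp (t * Z n \<omega>) - iexp (t * Y n \<omega>)) \<le> \<bar>t\<bar> * \<bar>Z n \<omega> - Y n \<omega>\<bar>"
          using iexp_lipschitz[of "t * Z n \<omega>" "t * Y n \<omega>"] 
          by (simp add: abs_mult flip: right_diff_distrib)
        also have "\<dots> \<le> \<bar>t\<bar> * \<epsilon> n"
          using elim by (intro mult_left_mono) auto
        finally show ?case .
      qed
    qed (auto intro!: integrable_norm Bochner_Integration.integrable_diff integrable_iexp)
    finally show ?case by (simp add: prob_space)
  qed
  moreover have "(\<lambda>n. \<bar>t\<bar> * \<epsilon> n) \<longlonglongrightarrow> 0"
    using \<epsilon> by (rule tendsto_mult_right_zero)
  ultimately have "(\<lambda>n. char (distr M borel (Z n)) t - char (distr M borel (Y n)) t) \<longlonglongrightarrow> 0"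
    by (rule Lim_null_comparison)
  from tendsto_add[OF this Y] show "(\<lambda>n. char (distr M borel (Z n)) t) \<longlonglongrightarrow> char \<mu> t"
    by simp
qed

text \<open>Multiplying by \<open>c\<close> replaces the characteristic function at \<open>t\<close>
  by its value at \<open>c * t\<close>, so both directions of Levy's theorem apply. With
  \<open>c = sqrt v\<close> this turns the standard normal limit into one of variance
  \<open>v\<close>.\<close>

lemma (in prob_space) weak_conv_m_scale:
  assumes [measurable]: "\<And>n. Y n \<in> borel_measurable M"
    and \<mu>: "real_distribution \<mu>"
    and conv: "weak_conv_m (\<lambda>n. distr M borel (Y n)) \<mu>"
  shows "weak_conv_m (\<lambda>n. distr M borel (\<lambda>\<omega>. c * Y n \<omega>)) (distr \<mu> borel ((*) c))"
proof -
  interpret \<mu>: real_distribution \<mu> by fact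
  have [simp]: "(*) c \<in> borel_measurable \<mu>"
    by (subst measurable_cong_sets[OF \<mu>.events_eq_borel refl]) measurable
  have "char (distr \<mu> borel ((*) c)) t = char \<mu> (c * t)" for t
    by (simp add: char_def integral_distr mult_ac)
  moreover have "(\<lambda>n. char (distr M borel (\<lambda>\<omega>. c * Y n \<omega>)) t) \<longlonglongrightarrow> char \<mu> (c * t)" for t
    using levy_continuity1[OF _ \<mu> conv, of "c * t"]
    by (simp add: char_def integral_distr mult_ac real_distribution_distr)
  ultimately show ?thesis
    by (intro levy_continuity real_distribution_distr \<mu>.real_distribution_distr) simp_all
qed

lemma normal_law_eq_distr_std_normal:
  assumes "v > 0"
  shows "normal_law 0 v = distr std_normal_distribution borel ((*) (sqrt v))"
proof -
  interpret N: prob_space std_normal_distribution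
    by (rule prob_space_normal_density) simp
  \<comment> \<open>The identity is a standard normal variable on its own law, so the affine rule
    gives the law of its multiple by \<open>sqrt v\<close>.\<close>
  have "distributed std_normal_distribution lborel (\<lambda>x. x) (normal_density 0 1)"
    by (auto simp: distributed_def distr_id2)
  from N.normal_density_affine[OF this, of "sqrt v" 0] show ?thesis
    using assms by (simp add: normal_law_def distributed_def cong: distr_cong)
qed

lemma real_distribution_normal_law: "v \<ge> 0 \<Longrightarrow> real_distribution (normal_law 0 v)"
  using prob_space_normal_density[of "sqrt v" 0]
  by (auto simp: normal_law_def real_distribution_def real_distribution_axioms_def
      intro!: prob_space_return)

section \<open>Discrete laws and measurability of discrete sums\<close>

text \<open>The point probabilities already add up to 1 on the countable set
  \<open>set_pmf f\<close>, so \<open>V\<close> almost surely lies there. Every Borel set can thus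
  be cut down to a countable set, on which countable additivity decides. The right-hand side is an
  image measure because \<open>measure_pmf f\<close> lives on the sigma-algebra of all sets.\<close>

lemma distr_eq_distr_pmf:
  fixes f :: "real pmf"
  assumes "prob_space M" and [measurable]: "V \<in> borel_measurable M"
    and pmf: "\<And>t. measure M {\<omega> \<in> space M. V \<omega> = t} = pmf f t"
  shows "distr M borel V = distr (measure_pmf f) borel (\<lambda>t. t)"
proof -
  interpret prob_space M by fact
  interpret D: prob_space "distr M borel V" by (rule prob_space_distr) simp
  have *: "emeasure (distr M borel V) B = emeasure (measure_pmf f) B" if "B \<subseteq> set_pmf f" for B
  proof -
    have B: "countable B"
      using that countable_set_pmf countable_subset by blast
    have "emeasure (distr M borel V) {t} = ennreal (pmf f t)" for t
      using pmf[of t]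
      by (simp add: emeasure_distr emeasure_eq_measure vimage_def Int_def conj_commute)
    then have "emeasure (distr M borel V) B = (\<integral>\<^sup>+t. ennreal (pmf f t) \<partial>count_space B)"
      using B by (subst emeasure_countable_singleton) auto
    then show ?thesis by (simp add: nn_integral_pmf)
  qed
  have "emeasure (distr M borel V) (set_pmf f) = 1"
    by (simp add: * emeasure_pmf)
  then have AE: "AE t in distr M borel V. t \<in> set_pmf f"
    by (intro D.AE_prob_1) (simp add: D.emeasure_eq_measure)
  show ?thesis
  proof (rule measure_eqI)
    fix A assume "A \<in> sets (distr M borel V)"
    then have A[measurable]: "A \<in> sets borel" by simp
    have [measurable]: "set_pmf f \<in> sets borel"
      by (rule sets.countable) (simp_all add: countable_set_pmf)
    have "emeasure (distr M borel V) A = emeasure (distr M borel V) (A \<inter> set_pmf f)"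
      proof (rule emeasure_eq_AE)
      show "AE t in distr M borel V. t \<in> A \<longleftrightarrow> t \<in> A \<inter> set_pmf f"
        using AE by eventually_elim simp
    qed simp_all
    also have "\<dots> = emeasure (measure_pmf f) A"
      by (simp add: * emeasure_Int_set_pmf)
    finally show "emeasure (distr M borel V) A = emeasure (distr (measure_pmf f) borel (\<lambda>t. t)) A"
      by (simp add: emeasure_distr)
  qed simp
qed

text \<open>Off the countable set \<open>set_pmf p\<close> the function agrees with the constant
  0.\<close>

lemma borel_measurable_pmf[measurable]: "pmf p \<in> borel_measurable (borel :: real measure)"
  by (rule measurable_discrete_difference[where f = "\<lambda>_. 0" and X = "set_pmf p"])
     (auto simp: set_pmf_iff)

text \<open>An enumeration of \<open>T\<close> turns the sum into a series in
  \<open>ennreal\<close>, whose value is always measurable. On divergence the series is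
  \<open>top\<close>, and \<open>enn2real\<close> maps this to 0, which is also the default value of
  \<open>infsum\<close>.\<close>

lemma borel_measurable_infsum:
  fixes g :: "'i \<Rightarrow> 'a \<Rightarrow> real"
  assumes T: "countable T" and g: "\<And>i. i \<in> T \<Longrightarrow> g i \<in> borel_measurable M"
    and nonneg: "\<And>i \<omega>. i \<in> T \<Longrightarrow> 0 \<le> g i \<omega>"
  shows "(\<lambda>\<omega>. \<Sum>\<^sub>\<infinity>i\<in>T. g i \<omega>) \<in> borel_measurable M"
proof (cases "finite T")
  case True
  then show ?thesis
    using g by simp
next
  case False
  define e where "e = from_nat_into T"
  have e: "bij_betw e UNIV T"
    unfolding e_def using T False by (rule bij_betw_from_nat_into)
  then have eT: "e k \<in> T" for k
    by (auto simp: bij_betw_def)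
  have meas: "g (e k) \<in> borel_measurable M" for k
    using eT by (rule g)
  have "(\<Sum>\<^sub>\<infinity>i\<in>T. g i \<omega>) = enn2real (\<Sum>k. ennreal (g (e k) \<omega>))" for \<omega>
  proof -
    have infsum: "(\<Sum>\<^sub>\<infinity>i\<in>T. g i \<omega>) = (\<Sum>\<^sub>\<infinity>k. g (e k) \<omega>)"
      using infsum_reindex_bij_betw[OF e, of "\<lambda>i. g i \<omega>"] by simp
    have pos: "g (e k) \<omega> \<ge> 0" for k
      using nonneg eT by simp
    show ?thesis
    proof (cases "summable (\<lambda>k. g (e k) \<omega>)")
      case True
      then have "((\<lambda>k. g (e k) \<omega>) has_sum (\<Sum>k. g (e k) \<omega>)) UNIV"
        using pos by (intro norm_summable_imp_has_sum) (auto intro: summable_sums)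
      then show ?thesis
        using True pos by (simp add: infsum infsumI suminf_ennreal2 suminf_nonneg)
    next
      case False
      then have "(\<Sum>k. ennreal (g (e k) \<omega>)) = top"
        using summable_suminf_not_top[where f = "\<lambda>k. g (e k) \<omega>", OF pos] by blast
      with False show ?thesis
        using pos by (simp add: infsum infsum_not_exists summable_on_UNIV_nonneg_real_iff)
    qed
  qed
  moreover have "(\<lambda>\<omega>. enn2real (\<Sum>k. ennreal (g (e k) \<omega>))) \<in> borel_measurable M"
    by (rule borel_measurable_enn2real, rule borel_measurable_suminf_order,
        rule measurable_compose[OF meas measurable_ennreal])
  ultimately show ?thesis by (simp only:)
qed

section \<open>Uniform bounds and inverse-square sums over separated sets\<close>

text \<open>Boundedness above, the first conjunct of \<open>sup_bigo\<close>, is what puts each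
  single value below the supremum.\<close>

lemma sup_bigoD:
  assumes "sup_bigo T g h"
  shows "\<exists>C\<ge>0. \<forall>\<^sub>F n in sequentially. \<forall>y\<in>T. g y n \<le> C * \<bar>h n\<bar>"
proof -
  from assms obtain C where C: "C > 0" "\<forall>\<^sub>F n in sequentially. norm (SUP y\<in>T. g y n) \<le> C * norm (h n)"
    and bdd: "\<forall>\<^sub>F n in sequentially. bdd_above ((\<lambda>y. g y n) ` T)"
    unfolding sup_bigo_def by (auto elim!: landau_o.bigE)
  have "\<forall>\<^sub>F n in sequentially. \<forall>y\<in>T. g y n \<le> C * \<bar>h n\<bar>"
    using C(2) bdd
  proof eventually_elim
    case (elim n)
    show ?case
    proof
      fix y assume "y \<in> T"
      then have "g y n \<le> (SUP y\<in>T. g y n)"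
        using elim(2) by (intro cSUP_upper)
      with elim(1) show "g y n \<le> C * \<bar>h n\<bar>" by simp
    qed
  qed
  with C(1) show ?thesis by (intro exI[of _ C]) auto
qed

text \<open>This is zeta(2): the term at \<open>k = 0\<close> vanishes because
  \<open>1 / 0 = 0\<close>.\<close>

definition inv_sq_sum :: real where
  "inv_sq_sum = (\<Sum>k. 1 / (real k)\<^sup>2)"

lemma summable_inv_sq: "summable (\<lambda>k. 1 / (real k)\<^sup>2)"
  using inverse_power_summable[of 2, where 'a = real] by (simp add: inverse_eq_divide)

lemma inv_sq_sum_nonneg: "inv_sq_sum \<ge> 0"
  unfolding inv_sq_sum_def by (intro suminf_nonneg summable_inv_sq) simp

text \<open>The floor is the index of the cell of length \<open>\<delta>\<close>, counted from
  \<open>u\<close>, that contains the point; two points of one cell are less than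
  \<open>\<delta>\<close> apart.\<close>

lemma separated_inj_floor:
  fixes F :: "real set"
  assumes \<delta>: "\<delta> > 0" and sep: "\<And>a b. a \<in> F \<Longrightarrow> b \<in> F \<Longrightarrow> a \<noteq> b \<Longrightarrow> \<delta> \<le> \<bar>a - b\<bar>"
  shows "inj_on (\<lambda>a. \<lfloor>(a - u) / \<delta>\<rfloor>) F"
proof (rule inj_onI, rule ccontr)
  fix a b assume ab: "a \<in> F" "b \<in> F" "\<lfloor>(a - u) / \<delta>\<rfloor> = \<lfloor>(b - u) / \<delta>\<rfloor>" "a \<noteq> b"
  have "\<bar>(a - u) / \<delta> - (b - u) / \<delta>\<bar> < 1"
    using ab(3) by linarith
  then have "\<bar>a - b\<bar> / \<delta> < 1"
    using \<delta> by (simp add: abs_divide flip: diff_divide_distrib)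
  with sep[OF ab(1,2,4)] \<delta> show False by (simp add: field_simps)
qed

text \<open>The cell index injects \<open>F\<close> into the integers. For the support
  \<open>T\<close> this gives the countability behind the measurability of the normalizing
  constant.\<close>

lemma separated_countable:
  fixes F :: "real set"
  assumes "\<delta> > 0" and "\<And>a b. a \<in> F \<Longrightarrow> b \<in> F \<Longrightarrow> a \<noteq> b \<Longrightarrow> \<delta> \<le> \<bar>a - b\<bar>"
  shows "countable F"
proof (rule countable_image_inj_on)
  show "inj_on (\<lambda>a. \<lfloor>(a - 0) / \<delta>\<rfloor>) F"
    using assms by (rule separated_inj_floor)
qed simp

text \<open>The cell indices \<open>m a\<close> are distinct positive integers with
  \<open>m a * \<delta> \<le> a - u\<close>, so the sum is dominated by distinct terms of the series
  \<open>inv_sq_sum\<close>, divided by \<open>\<delta>\<^sup>2\<close>.\<close>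

lemma separated_right_inv_sq_sum_le:
  fixes F :: "real set"
  assumes F: "finite F" and \<delta>: "\<delta> > 0"
    and sep: "\<And>a b. a \<in> F \<Longrightarrow> b \<in> F \<Longrightarrow> a \<noteq> b \<Longrightarrow> \<delta> \<le> \<bar>a - b\<bar>"
    and u: "\<And>a. a \<in> F \<Longrightarrow> u + \<delta> \<le> a"
  shows "(\<Sum>a\<in>F. 1 / (a - u)\<^sup>2) \<le> inv_sq_sum / \<delta>\<^sup>2"
proof -
  define m where "m a = nat \<lfloor>(a - u) / \<delta>\<rfloor>" for a
  have ge1: "(a - u) / \<delta> \<ge> 1" if "a \<in> F" for a
    using u[OF that] \<delta> by (simp add: field_simps)
  have m: "real (m a) \<le> (a - u) / \<delta>" "m a \<ge> 1" if "a \<in> F" for a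
    using ge1[OF that] unfolding m_def by linarith+
  have inj: "inj_on m F"
  proof (rule inj_onI)
    fix a b assume ab: "a \<in> F" "b \<in> F" "m a = m b"
    \<comment> \<open>Both floors are at least 1, so \<open>nat\<close> does not identify different
      ones.\<close>
    have "\<lfloor>(a - u) / \<delta>\<rfloor> = \<lfloor>(b - u) / \<delta>\<rfloor>"
      using ge1[OF ab(1)] ge1[OF ab(2)] ab(3) unfolding m_def by linarith
    then show "a = b"
      using inj_onD[OF separated_inj_floor[OF \<delta> sep]] ab by blast
  qed
  have "(\<Sum>a\<in>F. 1 / (a - u)\<^sup>2) \<le> (\<Sum>a\<in>F. 1 / (real (m a))\<^sup>2 / \<delta>\<^sup>2)"
  proof (rule sum_mono)
    fix a assume a: "a \<in> F"
    have "real (m a) * \<delta> \<le> a - u"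
      using m(1)[OF a] \<delta> by (simp add: field_simps)
    then have "(real (m a) * \<delta>)\<^sup>2 \<le> (a - u)\<^sup>2"
      using \<delta> by (intro power_mono) auto
    then have "1 / (a - u)\<^sup>2 \<le> 1 / (real (m a) * \<delta>)\<^sup>2"
      using m(2)[OF a] \<delta> ge1[OF a]
      by (intro divide_left_mono mult_pos_pos) (auto simp: le_divide_eq)
    then show "1 / (a - u)\<^sup>2 \<le> 1 / (real (m a))\<^sup>2 / \<delta>\<^sup>2"
      by (simp add: power_mult_distrib)
  qed
  also have "\<dots> = (\<Sum>k\<in>m ` F. 1 / (real k)\<^sup>2) / \<delta>\<^sup>2"
    by (simp add: sum.reindex[OF inj] sum_divide_distrib)
  also have "\<dots> \<le> inv_sq_sum / \<delta>\<^sup>2"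
    unfolding inv_sq_sum_def using F
    by (intro divide_right_mono sum_le_suminf summable_inv_sq) auto
  finally show ?thesis .
qed

text \<open>The gap around \<open>u\<close> splits \<open>F\<close> into points right and left of
  \<open>u\<close>. Reflection reduces the left half to the one-sided bound, whence the factor
  2.\<close>

lemma separated_inv_sq_sum_le:
  fixes F :: "real set"
  assumes F: "finite F" and \<delta>: "\<delta> > 0"
    and sep: "\<And>a b. a \<in> F \<Longrightarrow> b \<in> F \<Longrightarrow> a \<noteq> b \<Longrightarrow> \<delta> \<le> \<bar>a - b\<bar>"
    and u: "\<And>a. a \<in> F \<Longrightarrow> \<delta> \<le> \<bar>a - u\<bar>"
  shows "(\<Sum>a\<in>F. 1 / (a - u)\<^sup>2) \<le> 2 * inv_sq_sum / \<delta>\<^sup>2"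
proof -
  let ?R = "{a \<in> F. u < a}" and ?L = "{a \<in> F. a < u}"
  have split: "F = ?R \<union> ?L"
    using u \<delta> by force
  have R: "(\<Sum>a\<in>?R. 1 / (a - u)\<^sup>2) \<le> inv_sq_sum / \<delta>\<^sup>2"
    using F u by (intro separated_right_inv_sq_sum_le \<delta>) (auto intro: sep; force)+
  have "(\<Sum>a\<in>uminus ` ?L. 1 / (a - (- u))\<^sup>2) \<le> inv_sq_sum / \<delta>\<^sup>2"
  proof (rule separated_right_inv_sq_sum_le)
    show "\<delta> \<le> \<bar>a - b\<bar>" if "a \<in> uminus ` ?L" "b \<in> uminus ` ?L" "a \<noteq> b" for a b
      using that sep[of "- a" "- b"] by (auto simp: abs_minus_commute)
    show "- u + \<delta> \<le> a" if "a \<in> uminus ` ?L" for a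
      using that u[of "- a"] by auto
  qed (use F \<delta> in auto)
  then have L: "(\<Sum>a\<in>?L. 1 / (a - u)\<^sup>2) \<le> inv_sq_sum / \<delta>\<^sup>2"
    by (simp add: sum.reindex power2_commute)
  have "(\<Sum>a\<in>F. 1 / (a - u)\<^sup>2) = (\<Sum>a\<in>?R. 1 / (a - u)\<^sup>2) + (\<Sum>a\<in>?L. 1 / (a - u)\<^sup>2)"
    using F by (subst split, subst sum.union_disjoint) auto
  with R L show ?thesis by simp
qed

section \<open>Chebyshev bounds for the kernel masses\<close>

text \<open>Chebyshev's inequality with the second moment taken about the target \<open>y\<close>
  instead of the mean, so that \<open>q\<close> accounts for variance and squared bias
  together.\<close>

lemma measure_pmf_far_le:
  fixes p :: "real pmf"
  assumes int: "integrable (measure_pmf p) (\<lambda>z. z\<^sup>2)" and "a > 0"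
    and q: "measure_pmf.expectation p (\<lambda>z. (z - y)\<^sup>2) \<le> q"
  shows "measure_pmf.prob p {z. a \<le> \<bar>z - y\<bar>} \<le> q / a\<^sup>2"
proof -
  have int1: "integrable (measure_pmf p) (\<lambda>z. z)"
    by (rule measure_pmf.square_integrable_imp_integrable) (use int in auto)
  have "integrable (measure_pmf p) (\<lambda>z. (z - y)\<^sup>2)"
    using int int1 by (auto simp: power2_diff)
  from measure_pmf.second_moment_method[OF _ this \<open>a > 0\<close>]
  have "measure_pmf.prob p {z. a \<le> \<bar>z - y\<bar>} \<le> measure_pmf.expectation p (\<lambda>z. (z - y)\<^sup>2) / a\<^sup>2"
    by simp
  also have "\<dots> \<le> q / a\<^sup>2"
    using q by (rule divide_right_mono) simp
  finally show ?thesis .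
qed

lemma pmf_far_le:
  fixes p :: "real pmf"
  assumes "integrable (measure_pmf p) (\<lambda>z. z\<^sup>2)" and "u \<noteq> y"
    and "measure_pmf.expectation p (\<lambda>z. (z - y)\<^sup>2) \<le> q"
  shows "pmf p u \<le> q / (y - u)\<^sup>2"
proof -
  have "pmf p u \<le> measure_pmf.prob p {z. \<bar>u - y\<bar> \<le> \<bar>z - y\<bar>}"
    unfolding measure_pmf_single[symmetric] by (intro measure_pmf.finite_measure_mono) auto
  also have "\<dots> \<le> q / \<bar>u - y\<bar>\<^sup>2"
    using assms by (intro measure_pmf_far_le) auto
  finally show ?thesis by (simp add: power2_commute)
qed

text \<open>All mass off \<open>y\<close> sits at distance at least \<open>\<delta>\<close>, so the
  Chebyshev bound at radius \<open>\<delta>\<close> controls the whole missing mass.\<close>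

lemma pmf_center_ge:
  fixes p :: "real pmf"
  assumes "integrable (measure_pmf p) (\<lambda>z. z\<^sup>2)" and "\<delta> > 0"
    and "measure_pmf.expectation p (\<lambda>z. (z - y)\<^sup>2) \<le> q"
    and iso: "\<And>z. z \<in> set_pmf p \<Longrightarrow> z \<noteq> y \<Longrightarrow> \<delta> \<le> \<bar>z - y\<bar>"
  shows "1 - q / \<delta>\<^sup>2 \<le> pmf p y"
proof -
  have "1 - pmf p y = measure_pmf.prob p (- {y})"
    using measure_pmf.prob_compl[of "{y}" p] by (simp add: measure_pmf_single Compl_eq_Diff_UNIV)
  also have "\<dots> \<le> measure_pmf.prob p {z. \<delta> \<le> \<bar>z - y\<bar>}"
    using iso by (intro measure_pmf.finite_measure_mono_AE) (auto simp: AE_measure_pmf_iff)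
  also have "\<dots> \<le> q / \<delta>\<^sup>2"
    using assms by (intro measure_pmf_far_le) auto
  finally show ?thesis by simp
qed

text \<open>Here the observation \<open>u\<close> is fixed and the target \<open>y\<close> varies,
  so the sum is not the total mass of one kernel. The diagonal term falls short of 1 by at most
  \<open>q / \<delta>\<^sup>2\<close>, and the other terms are dominated by
  \<open>q / (y - u)\<^sup>2\<close>, summed by the inverse-square bound.\<close>

lemma kernel_column_sum:
  fixes k :: "real \<Rightarrow> real pmf"
  assumes \<delta>: "\<delta> > 0"
    and sep: "\<And>y z. y \<in> T \<Longrightarrow> z \<in> T \<Longrightarrow> z \<noteq> y \<Longrightarrow> \<delta> \<le> \<bar>z - y\<bar>"
    and iso: "\<And>y z. y \<in> T \<Longrightarrow> z \<in> set_pmf (k y) \<Longrightarrow> z \<noteq> y \<Longrightarrow> \<delta> \<le> \<bar>z - y\<bar>"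
    and int: "\<And>y. y \<in> T \<Longrightarrow> integrable (measure_pmf (k y)) (\<lambda>z. z\<^sup>2)"
    and q: "\<And>y. y \<in> T \<Longrightarrow> measure_pmf.expectation (k y) (\<lambda>z. (z - y)\<^sup>2) \<le> q"
    and u: "u \<in> T"
  shows "(\<lambda>y. pmf (k y) u) summable_on T"
    and "\<bar>(\<Sum>\<^sub>\<infinity>y\<in>T. pmf (k y) u) - 1\<bar> \<le> q * (2 * inv_sq_sum + 1) / \<delta>\<^sup>2"
proof -
  have q0: "q \<ge> 0"
    using q[OF u] by (rule order_trans[rotated]) simp
  \<comment> \<open>One bound for all finite partial sums gives both summability and the estimate of
    the infinite sum.\<close>
  have fin: "(\<Sum>y\<in>F. pmf (k y) u) \<le> q * (2 * inv_sq_sum / \<delta>\<^sup>2)" if F: "finite F" "F \<subseteq> T - {u}" for F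
  proof -
    have "(\<Sum>y\<in>F. pmf (k y) u) \<le> (\<Sum>y\<in>F. q * (1 / (y - u)\<^sup>2))"
      using F pmf_far_le[OF int _ q] by (intro sum_mono) (auto simp: subset_iff)
    also have "\<dots> \<le> q * (2 * inv_sq_sum / \<delta>\<^sup>2)"
      unfolding sum_distrib_left[symmetric]
      using F u q0 by (intro mult_left_mono separated_inv_sq_sum_le \<delta> sep) auto
    finally show ?thesis .
  qed
  have off: "(\<lambda>y. pmf (k y) u) summable_on (T - {u})"
    by (rule nonneg_bdd_above_summable_on) (auto intro!: bdd_aboveI2 fin)
  have T: "T = insert u (T - {u})"
    using u by auto
  show "(\<lambda>y. pmf (k y) u) summable_on T"
    using off by (subst T) (simp only: summable_on_insert_iff)
  have sum: "(\<Sum>\<^sub>\<infinity>y\<in>T. pmf (k y) u) = pmf (k u) u + (\<Sum>\<^sub>\<infinity>y\<in>T - {u}. pmf (k y) u)"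
    by (subst T) (rule infsum_insert[OF off], simp)
  have "(\<Sum>\<^sub>\<infinity>y\<in>T - {u}. pmf (k y) u) \<le> q * (2 * inv_sq_sum / \<delta>\<^sup>2)"
    using off fin by (rule infsum_le_finite_sums)
  moreover have "(\<Sum>\<^sub>\<infinity>y\<in>T - {u}. pmf (k y) u) \<ge> 0"
    by (rule infsum_nonneg) simp
  moreover have "1 - q / \<delta>\<^sup>2 \<le> pmf (k u) u"
    using u by (intro pmf_center_ge int q iso \<delta>)
  moreover have "pmf (k u) u \<le> 1"
    by (rule pmf_le_1)
  moreover have "q * (2 * inv_sq_sum + 1) / \<delta>\<^sup>2 = q * (2 * inv_sq_sum / \<delta>\<^sup>2) + q / \<delta>\<^sup>2"
    by (simp add: add_divide_distrib algebra_simps)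
  moreover have "q / \<delta>\<^sup>2 \<ge> 0" "q * (2 * inv_sq_sum / \<delta>\<^sup>2) \<ge> 0"
    using q0 inv_sq_sum_nonneg by simp_all
  ultimately show "\<bar>(\<Sum>\<^sub>\<infinity>y\<in>T. pmf (k y) u) - 1\<bar> \<le> q * (2 * inv_sq_sum + 1) / \<delta>\<^sup>2"
    unfolding sum by linarith
qed

text \<open>Chebyshev's inequality yields the error \<open>q / \<delta>\<^sup>2\<close>, on and off
  the diagonal. It is enlarged so that numerator and normalizing constant share one error
  bound.\<close>

lemma kernel_row_close:
  fixes k :: "real \<Rightarrow> real pmf"
  assumes \<delta>: "\<delta> > 0"
    and sep: "\<And>y z. y \<in> T \<Longrightarrow> z \<in> T \<Longrightarrow> z \<noteq> y \<Longrightarrow> \<delta> \<le> \<bar>z - y\<bar>"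
    and iso: "\<And>y z. y \<in> T \<Longrightarrow> z \<in> set_pmf (k y) \<Longrightarrow> z \<noteq> y \<Longrightarrow> \<delta> \<le> \<bar>z - y\<bar>"
    and int: "\<And>y. y \<in> T \<Longrightarrow> integrable (measure_pmf (k y)) (\<lambda>z. z\<^sup>2)"
    and q: "\<And>y. y \<in> T \<Longrightarrow> measure_pmf.expectation (k y) (\<lambda>z. (z - y)\<^sup>2) \<le> q"
    and "x \<in> T" "u \<in> T"
  shows "\<bar>pmf (k x) u - indicator {x} u\<bar> \<le> q * (2 * inv_sq_sum + 1) / \<delta>\<^sup>2"
proof -
  have q0: "q \<ge> 0"
    using q[OF \<open>x \<in> T\<close>] by (rule order_trans[rotated]) simp
  have "\<bar>pmf (k x) u - indicator {x} u\<bar> \<le> q / \<delta>\<^sup>2"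
  proof (cases "u = x")
    case True
    have "1 - q / \<delta>\<^sup>2 \<le> pmf (k x) x"
      using \<open>x \<in> T\<close> by (intro pmf_center_ge int q iso \<delta>)
    with True show ?thesis by (simp add: pmf_le_1)
  next
    case False
    have "pmf (k x) u \<le> q / (x - u)\<^sup>2"
      using False \<open>x \<in> T\<close> by (intro pmf_far_le int q)
    also have "\<dots> \<le> q / \<delta>\<^sup>2"
    proof (rule divide_left_mono)
      have "\<delta> \<le> \<bar>x - u\<bar>"
        using sep[of u x] False assms by auto
      then show "\<delta>\<^sup>2 \<le> (x - u)\<^sup>2"
        using \<delta> power_mono[of \<delta> "\<bar>x - u\<bar>" 2] by simp
    qed (use q0 \<delta> False in auto)
    finally show ?thesis using False by simp
  qed
  also have "\<dots> \<le> q * (2 * inv_sq_sum + 1) / \<delta>\<^sup>2"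
    using mult_left_mono[of 1 "2 * inv_sq_sum + 1" q] q0 inv_sq_sum_nonneg
    by (intro divide_right_mono) auto
  finally show ?thesis .
qed

section \<open>Deterministic comparison of the normalized estimator with the empirical
  frequency\<close>

lemma has_sum_finite_sum:
  fixes g :: "'i \<Rightarrow> 'a \<Rightarrow> real"
  assumes "finite I" and "\<And>i. i \<in> I \<Longrightarrow> (g i has_sum s i) A"
  shows "((\<lambda>y. \<Sum>i\<in>I. g i y) has_sum (\<Sum>i\<in>I. s i)) A"
  using assms by (induction rule: finite_induct) (auto intro!: has_sum_add)

lemma abs_mean_diff_le:
  fixes a b :: "nat \<Rightarrow> real"
  assumes "n \<ge> 1" and "\<And>i. i \<in> {1..n} \<Longrightarrow> \<bar>a i - b i\<bar> \<le> e"
  shows "\<bar>(\<Sum>i=1..n. a i) / real n - (\<Sum>i=1..n. b i) / real n\<bar> \<le> e"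
proof -
  have "\<bar>(\<Sum>i=1..n. a i) - (\<Sum>i=1..n. b i)\<bar> \<le> (\<Sum>i=1..n. \<bar>a i - b i\<bar>)"
    unfolding sum_subtractf[symmetric] by (rule sum_abs)
  also have "\<dots> \<le> real n * e"
    using sum_bounded_above[of "{1..n}" "\<lambda>i. \<bar>a i - b i\<bar>" e] assms(2) by simp
  finally show ?thesis
    using \<open>n \<ge> 1\<close> by (simp add: abs_divide field_simps flip: diff_divide_distrib)
qed

text \<open>Write \<open>a / c - b = (a - b * c) / c\<close>. The numerator is at most
  \<open>\<bar>a - b\<bar> + b * \<bar>c - 1\<bar> \<le> 2 * e\<close> in absolute value, and
  dividing by \<open>c \<ge> 1 / 2\<close> at most doubles it.\<close>

lemma normalized_close:
  fixes a b c e :: real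
  assumes "\<bar>c - 1\<bar> \<le> e" "\<bar>a - b\<bar> \<le> e" "e \<le> 1 / 2" "0 \<le> b" "b \<le> 1"
  shows "\<bar>a / c - b\<bar> \<le> 4 * e"
proof -
  have c: "c \<ge> 1 / 2" using assms by linarith
  have "\<bar>b * (c - 1)\<bar> \<le> 1 * e"
    unfolding abs_mult using assms by (intro mult_mono) auto
  then have "\<bar>a - b * c\<bar> \<le> 2 * e"
    using assms(2) by (simp add: right_diff_distrib)
  moreover have "2 * e \<le> 4 * e * c"
    using c assms(1) mult_left_mono[of "1/2" c "4 * e"] by auto
  moreover have "a / c - b = (a - b * c) / c"
    using c by (simp add: field_simps)
  ultimately show ?thesis
    using c by (simp add: abs_divide divide_le_eq mult_ac)
qed

text \<open>A statement about one outcome \<open>\<omega>\<close> and one \<open>n\<close>: the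
  column sums put the normalizing constant near 1, the row estimate puts the unnormalized estimator
  near the empirical frequency, and \<open>normalized_close\<close> combines the two.\<close>

lemma normalized_estimator_close:
  assumes \<delta>: "\<delta> > 0"
    and sep: "\<And>y z. y \<in> T \<Longrightarrow> z \<in> T \<Longrightarrow> z \<noteq> y \<Longrightarrow> \<delta> \<le> \<bar>z - y\<bar>"
    and iso: "\<And>y z. y \<in> T \<Longrightarrow> z \<in> set_pmf (K y (h n)) \<Longrightarrow> z \<noteq> y \<Longrightarrow> \<delta> \<le> \<bar>z - y\<bar>"
    and int: "\<And>y. y \<in> T \<Longrightarrow> integrable (measure_pmf (K y (h n))) (\<lambda>z. z\<^sup>2)"
    and q: "\<And>y. y \<in> T \<Longrightarrow> measure_pmf.expectation (K y (h n)) (\<lambda>z. (z - y)\<^sup>2) \<le> q"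
    and x: "x \<in> T" and X: "\<And>i. i \<ge> 1 \<Longrightarrow> X i \<omega> \<in> T" and n: "n \<ge> 1"
    and small: "q * (2 * inv_sq_sum + 1) / \<delta>\<^sup>2 \<le> 1 / 2"
  shows "\<bar>normalized_estimator T K h X n x \<omega> - (\<Sum>i=1..n. indicator {x} (X i \<omega>)) / real n\<bar>
    \<le> 4 * (q * (2 * inv_sq_sum + 1) / \<delta>\<^sup>2)"
  unfolding normalized_estimator_def
proof (rule normalized_close)
  let ?e = "q * (2 * inv_sq_sum + 1) / \<delta>\<^sup>2"
  have sum: "(\<lambda>y. pmf (K y (h n)) (X i \<omega>)) summable_on T"
    "\<bar>(\<Sum>\<^sub>\<infinity>y\<in>T. pmf (K y (h n)) (X i \<omega>)) - 1\<bar> \<le> ?e" if "i \<in> {1..n}" for i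
    using kernel_column_sum[where k = "\<lambda>y. K y (h n)", OF \<delta> sep iso int q X] that by simp_all
  \<comment> \<open>Exchanging the sums, legitimate since every column is summable, exhibits the
    normalizing constant as the mean of the column sums at the sample points.\<close>
  have "((\<lambda>y. kernel_estimator K h X n y \<omega>) has_sum
      (\<Sum>i=1..n. \<Sum>\<^sub>\<infinity>y\<in>T. pmf (K y (h n)) (X i \<omega>)) / real n) T"
    unfolding kernel_estimator_def divide_inverse
    by (intro has_sum_cmult_left has_sum_finite_sum has_sum_infsum sum(1) finite_atLeastAtMost)
  then have "normalizing_constant T K h X n \<omega>
      = (\<Sum>i=1..n. \<Sum>\<^sub>\<infinity>y\<in>T. pmf (K y (h n)) (X i \<omega>)) / real n"
    unfolding normalizing_constant_def by (rule infsumI)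
  then show "\<bar>normalizing_constant T K h X n \<omega> - 1\<bar> \<le> ?e"
    using abs_mean_diff_le[OF n sum(2)] n by simp
  show "\<bar>kernel_estimator K h X n x \<omega> - (\<Sum>i=1..n. indicator {x} (X i \<omega>)) / real n\<bar> \<le> ?e"
    unfolding kernel_estimator_def
    by (intro abs_mean_diff_le n kernel_row_close[where k = "\<lambda>y. K y (h n)" and T = T] \<delta> sep iso int q x X) auto
  show "(\<Sum>i=1..n. indicator {x} (X i \<omega>)) / real n \<le> 1"
    using sum_bounded_above[of "{1..n}" "\<lambda>i. indicator {x} (X i \<omega>)" "1::real"] n
    by (simp add: indicator_def divide_le_eq)
qed (use small in \<open>auto intro!: divide_nonneg_nonneg sum_nonneg\<close>)

section \<open>Central limit theorem for the empirical frequency\<close>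

text \<open>Samples are indexed from 1, whereas the central limit theorem is applied to a sequence
  indexed from 0. Product formulas carry over by relabelling along the injection
  \<open>Suc\<close>.\<close>

lemma (in prob_space) indep_vars_Suc:
  assumes "indep_vars (\<lambda>_. N) X {1..}"
  shows "indep_vars (\<lambda>_. N) (\<lambda>i. X (Suc i)) UNIV"
proof -
  have rv: "random_variable N (X i)" if "i \<ge> 1" for i
    using assms that by (auto simp: indep_vars_def2)
  have ind: "indep_sets (\<lambda>i. {X i -` A \<inter> space M | A. A \<in> sets N}) {1..}"
    using assms by (simp add: indep_vars_def2)
  have "indep_sets (\<lambda>i. {X (Suc i) -` A \<inter> space M | A. A \<in> sets N}) UNIV"
  proof (rule indep_setsI)
    fix A and J :: "nat set"
    assume J: "J \<noteq> {}" "finite J"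
      and A: "\<forall>j\<in>J. A j \<in> {X (Suc j) -` A \<inter> space M | A. A \<in> sets N}"
    have "prob (\<Inter>j\<in>Suc ` J. A (j - 1)) = (\<Prod>j\<in>Suc ` J. prob (A (j - 1)))"
      using J A by (intro indep_setsD[OF ind]) auto
    then show "prob (\<Inter>j\<in>J. A j) = (\<Prod>j\<in>J. prob (A j))"
      by (simp add: prod.reindex image_image)
  qed (use rv in auto)
  with rv show ?thesis by (simp add: indep_vars_def2)
qed

text \<open>The indicators of \<open>X i = x\<close> are i.i.d. Bernoulli variables with parameter
  \<open>pmf f x\<close>. For positive variance the standardized limit is rescaled by
  \<open>sqrt v\<close>; for zero variance the indicators are almost surely constant.\<close>

lemma (in prob_space) empirical_frequency_clt:
  fixes f :: "real pmf" and x :: real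
  assumes indep: "indep_vars (\<lambda>_. borel) X {1..}"
    and pmf: "\<And>i t. i \<ge> 1 \<Longrightarrow> prob {\<omega> \<in> space M. X i \<omega> = t} = pmf f t"
  shows "weak_conv_m
    (\<lambda>n. distr M borel (\<lambda>\<omega>. sqrt (real n) * ((\<Sum>i=1..n. indicator {x} (X i \<omega>)) / real n - pmf f x)))
    (normal_law 0 (pmf f x * (1 - pmf f x)))"
proof -
  define v where "v = pmf f x * (1 - pmf f x)"
  have rv: "random_variable borel (X i)" if "i \<ge> 1" for i
    using indep that by (auto simp: indep_vars_def2)
  have [measurable]: "random_variable borel (X (Suc i))" for i
    using rv by simp
  define B :: "nat \<Rightarrow> 'a \<Rightarrow> real" where "B i \<omega> = indicator {x} (X (Suc i) \<omega>)" for i \<omega>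
  have [measurable]: "B i \<in> borel_measurable M" for i
    unfolding B_def by measurable
  have law: "distr M borel (X (Suc i)) = distr (measure_pmf f) borel (\<lambda>t. t)" for i
    by (rule distr_eq_distr_pmf) (use pmf in \<open>auto intro: prob_space_axioms\<close>)
  have B_distr: "distr M borel (B i) = distr (measure_pmf f) borel (indicator {x})" for i
  proof -
    have "distr M borel (B i) = distr (distr M borel (X (Suc i))) borel (indicator {x})"
      by (subst distr_distr) (auto simp: B_def[abs_def] comp_def)
    then show ?thesis
      unfolding law by (subst (asm) distr_distr) (auto simp: comp_def)
  qed
  have mean: "expectation (B i) = pmf f x" for i
  proof -
    have "expectation (B i) = prob {\<omega> \<in> space M. X (Suc i) \<omega> = x}"
      unfolding B_def[abs_def]
      by (subst Bochner_Integration.integral_cong[OF refl,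
            where g = "indicator {\<omega> \<in> space M. X (Suc i) \<omega> = x}"])
         (auto simp: indicator_def)
    then show ?thesis using pmf by simp
  qed
  have B_sq: "(B i \<omega>)\<^sup>2 = B i \<omega>" for i \<omega>
    by (simp add: B_def indicator_def)
  have int: "integrable M (B i)" for i
    by (rule integrable_const_bound[where B = 1]) (auto simp: B_def indicator_def)
  have var: "variance (B i) = v" for i
    by (subst variance_eq) (simp_all add: int mean B_sq v_def, simp add: power2_eq_square algebra_simps)
  have v0: "v \<ge> 0"
    unfolding v_def by (intro mult_nonneg_nonneg) (simp_all add: pmf_le_1)
  define Y where "Y n \<omega> = (\<Sum>i<n. B i \<omega> - pmf f x) / sqrt (real n)" for n \<omega>
  \<comment> \<open>For \<open>n = 0\<close> both sides are 0, by \<open>sqrt 0 = 0\<close> and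
    division by zero.\<close>
  have Y_eq: "sqrt (real n) * ((\<Sum>i=1..n. indicator {x} (X i \<omega>)) / real n - pmf f x) = Y n \<omega>" for n \<omega>
  proof (cases "n = 0")
    case False
    have "(\<Sum>i=1..n. indicator {x} (X i \<omega>)) = (\<Sum>i<n. B i \<omega>)"
      unfolding B_def by (rule sum.reindex_bij_witness[of _ Suc "\<lambda>i. i - 1"]) auto
    then have "(\<Sum>i=1..n. indicator {x} (X i \<omega>)) / real n - pmf f x = (\<Sum>i<n. B i \<omega> - pmf f x) / real n"
      using False by (simp add: sum_subtractf field_simps)
    moreover have "sqrt (real n) * (s / real n) = s / sqrt (real n)" for s
      using False by (simp add: field_simps)
    ultimately show ?thesis by (simp only: Y_def)
  qed (simp add: Y_def)
  have Y_measurable[measurable]: "Y n \<in> borel_measurable M" for n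
    unfolding Y_def by measurable
  have "weak_conv_m (\<lambda>n. distr M borel (Y n)) (normal_law 0 v)"
  proof (cases "v = 0")
    \<comment> \<open>The limit is a point mass, which the central limit theorem does not cover.\<close>
    case True
    have "AE \<omega> in M. \<forall>i. B i \<omega> = pmf f x"
      unfolding AE_all_countable
    proof
      fix i
      have "AE \<omega> in M. (B i \<omega> - expectation (B i))\<^sup>2 = 0"
      proof (rule integral_nonneg_eq_0_iff_AE[THEN iffD1])
        show "integrable M (\<lambda>\<omega>. (B i \<omega> - expectation (B i))\<^sup>2)"
          using int[of i] by (simp add: power2_diff B_sq)
        show "variance (B i) = 0"
          unfolding var by fact
      qed (rule AE_I2, rule zero_le_power2)
      then show "AE \<omega> in M. B i \<omega> = pmf f x"
        unfolding mean by eventually_elim simp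
    qed
    then have "AE \<omega> in M. \<bar>Y n \<omega> - 0\<bar> \<le> 0" for n
      by eventually_elim (simp add: Y_def)
    then have "\<forall>\<^sub>F n in sequentially. AE \<omega> in M. \<bar>Y n \<omega> - 0\<bar> \<le> 0"
      by simp
    moreover have "weak_conv_m (\<lambda>n. distr M borel (\<lambda>\<omega>. 0)) (normal_law 0 v)"
    proof -
      have "distr M borel (\<lambda>\<omega>. 0) = normal_law 0 v"
        using True unfolding normal_law_def if_P[OF True] by (intro distr_const) simp
      then show ?thesis
        unfolding weak_conv_m_def weak_conv_def by simp
    qed
    \<comment> \<open>As \<open>Y n\<close> vanishes almost surely, it is compared with the constant
      sequence 0, with error 0.\<close>
    ultimately show ?thesis
      by (intro weak_conv_m_close[OF _ Y_measurable real_distribution_normal_law[OF v0],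
            where Y = "\<lambda>_ _. 0" and \<epsilon> = "\<lambda>_. 0"]) simp_all
  next
    case False
    with v0 have v: "v > 0" by simp
    have "weak_conv_m (\<lambda>n. distr M borel (\<lambda>\<omega>. (\<Sum>i<n. B i \<omega> - pmf f x) / sqrt (real n * (sqrt v)\<^sup>2)))
        std_normal_distribution"
    proof (rule central_limit_theorem)
      show "indep_vars (\<lambda>_. borel) B UNIV"
        using indep_vars_compose2[OF indep_vars_Suc[OF indep], of "\<lambda>_. indicator {x}" "\<lambda>_. borel"]
        unfolding B_def[abs_def] by simp
      show "distr M borel (B i) = distr (measure_pmf f) borel (indicator {x})" for i
        by (rule B_distr)
    qed (use v var mean int in \<open>auto simp: B_sq\<close>)
    then have "weak_conv_m (\<lambda>n. distr M borel (\<lambda>\<omega>. sqrt v *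
        ((\<Sum>i<n. B i \<omega> - pmf f x) / sqrt (real n * (sqrt v)\<^sup>2)))) (normal_law 0 v)"
      unfolding normal_law_eq_distr_std_normal[OF v]
      by (intro weak_conv_m_scale real_dist_normal_dist) auto
    \<comment> \<open>The factor \<open>sqrt v\<close> undoes the standardization by the standard
      deviation.\<close>
    also have "(\<lambda>n \<omega>. sqrt v * ((\<Sum>i<n. B i \<omega> - pmf f x) / sqrt (real n * (sqrt v)\<^sup>2))) = Y"
      using v by (intro ext) (simp add: Y_def real_sqrt_mult)
    finally show ?thesis .
  qed
  then show ?thesis by (simp only: Y_eq v_def)
qed

section \<open>Second moments of the kernels and the limit law of the normalized estimator\<close>

text \<open>The second moment about \<open>y\<close> is the variance plus the squared bias. The
  squared bias is of order \<open>(h n)\<^sup>2\<close>, which is at most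
  \<open>\<bar>h n\<bar>\<close> once \<open>\<bar>h n\<bar> < 1\<close>.\<close>

lemma kernel_second_moment_bigo:
  fixes K :: "real \<Rightarrow> real \<Rightarrow> real pmf"
  assumes h: "h \<longlonglongrightarrow> 0"
    and int: "\<forall>\<^sub>F n in sequentially. \<forall>y\<in>T. integrable (measure_pmf (K y (h n))) (\<lambda>z. z\<^sup>2)"
    and bias: "sup_bigo T (\<lambda>y n. \<bar>measure_pmf.expectation (K y (h n)) (\<lambda>z. z) - y\<bar>) h"
    and var: "sup_bigo T (\<lambda>y n. measure_pmf.variance (K y (h n)) (\<lambda>z. z)) h"
  shows "\<exists>C. \<forall>\<^sub>F n in sequentially. \<forall>y\<in>T.
    measure_pmf.expectation (K y (h n)) (\<lambda>z. (z - y)\<^sup>2) \<le> C * \<bar>h n\<bar>"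
proof -
  obtain C1 where C1: "C1 \<ge> 0" "\<forall>\<^sub>F n in sequentially. \<forall>y\<in>T.
      \<bar>measure_pmf.expectation (K y (h n)) (\<lambda>z. z) - y\<bar> \<le> C1 * \<bar>h n\<bar>"
    using sup_bigoD[OF bias] by blast
  obtain C2 where C2: "\<forall>\<^sub>F n in sequentially. \<forall>y\<in>T.
      measure_pmf.variance (K y (h n)) (\<lambda>z. z) \<le> C2 * \<bar>h n\<bar>"
    using sup_bigoD[OF var] by blast
  have "\<forall>\<^sub>F n in sequentially. \<bar>h n\<bar> < 1"
    using order_tendstoD(2)[OF tendsto_rabs_zero[OF h], of 1] by simp
  with int C1(2) C2 have "\<forall>\<^sub>F n in sequentially. \<forall>y\<in>T.
      measure_pmf.expectation (K y (h n)) (\<lambda>z. (z - y)\<^sup>2) \<le> (C2 + C1\<^sup>2) * \<bar>h n\<bar>"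
  proof eventually_elim
    case (elim n)
    show ?case
    proof
      fix y assume y: "y \<in> T"
      let ?p = "K y (h n)"
      let ?E = "measure_pmf.expectation ?p"
      have int2: "integrable (measure_pmf ?p) (\<lambda>z. z\<^sup>2)"
        using elim y by blast
      have int1: "integrable (measure_pmf ?p) (\<lambda>z. z)"
        by (rule measure_pmf.square_integrable_imp_integrable) (use int2 in auto)
      have "?E (\<lambda>z. (z - y)\<^sup>2) = ?E (\<lambda>z. (z - ?E (\<lambda>z. z))\<^sup>2) + (?E (\<lambda>z. z) - y)\<^sup>2"
        using int1 int2 by (simp add: power2_diff power2_eq_square algebra_simps)
      also have "\<dots> \<le> C2 * \<bar>h n\<bar> + (C1 * \<bar>h n\<bar>)\<^sup>2"
      proof (rule add_mono)
        show "(?E (\<lambda>z. z) - y)\<^sup>2 \<le> (C1 * \<bar>h n\<bar>)\<^sup>2"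
          using elim y power_mono[of "\<bar>?E (\<lambda>z. z) - y\<bar>" "C1 * \<bar>h n\<bar>" 2] by simp
      qed (use elim y in blast)
      also have "(C1 * \<bar>h n\<bar>)\<^sup>2 \<le> C1\<^sup>2 * \<bar>h n\<bar>"
        unfolding power_mult_distrib power2_eq_square[of "\<bar>h n\<bar>"]
        using elim mult_left_mono[of "\<bar>h n\<bar>" 1 "\<bar>h n\<bar>"] by (intro mult_left_mono) simp_all
      finally show "?E (\<lambda>z. (z - y)\<^sup>2) \<le> (C2 + C1\<^sup>2) * \<bar>h n\<bar>"
        by (simp add: algebra_simps)
    qed
  qed
  then show ?thesis by blast
qed

theorem theorem2p4:
  fixes M :: "'w measure"
    and T :: "real set"
    and f :: "real pmf"
    and X :: "nat \<Rightarrow> 'w \<Rightarrow> real"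
    and h :: "nat \<Rightarrow> real"
    and S :: "real \<Rightarrow> real set"
    and K :: "real \<Rightarrow> real \<Rightarrow> real pmf"
    and x :: real
  assumes "prob_space M"
    and "topological_space_class.discrete T" and "set_pmf f \<subseteq> T"
    and "prob_space.indep_vars M (\<lambda>_. borel) X {1..}"
    and "\<And>i t. i \<ge> 1 \<Longrightarrow> measure M {\<omega> \<in> space M. X i \<omega> = t} = pmf f t"
    and "\<And>n. n \<ge> 1 \<Longrightarrow> h n > 0" and "h \<longlonglongrightarrow> 0"
    and "\<And>y. y \<in> T \<Longrightarrow> topological_space_class.discrete (S y)"
    and "uniformly_isolated T S"
    and "\<And>y b. y \<in> T \<Longrightarrow> b > 0 \<Longrightarrow> set_pmf (K y b) \<subseteq> S y"
    and "\<And>n. n \<ge> 1 \<Longrightarrow> AE \<omega> in M. normalizing_constant T K h X n \<omega> > 0"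
    and "\<And>y. y \<in> T \<Longrightarrow> y \<in> S y"
    and "\<forall>\<^sub>F n in sequentially. \<forall>y\<in>T. integrable (measure_pmf (K y (h n))) (\<lambda>z. z\<^sup>2)"
    and "sup_bigo T (\<lambda>y n. \<bar>measure_pmf.expectation (K y (h n)) (\<lambda>z. z) - y\<bar>) h"
    and "sup_bigo T (\<lambda>y n. measure_pmf.variance (K y (h n)) (\<lambda>z. z)) h"
    and "(\<lambda>n. sqrt (real n) * h n) \<longlonglongrightarrow> 0"
    and "x \<in> T" and "pmf f x > 0"
  shows "weak_conv_m
           (\<lambda>n. distr M borel (\<lambda>\<omega>. sqrt (real n) * (normalized_estimator T K h X n x \<omega> - pmf f x)))
           (normal_law 0 (pmf f x * (1 - pmf f x)))"
proof -
  interpret prob_space M by fact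
  note int = assms(13)
  have rv: "random_variable borel (X i)" if "i \<in> {1..n}" for i n
    using assms(4) that by (auto simp: indep_vars_def2)
  obtain \<delta> where \<delta>: "\<delta> > 0" and iso: "\<And>y z. y \<in> T \<Longrightarrow> z \<in> T \<union> S y \<Longrightarrow> z \<noteq> y \<Longrightarrow> \<delta> \<le> \<bar>z - y\<bar>"
    using assms(9) unfolding uniformly_isolated_def by blast
  have "countable T"
    using \<delta> by (rule separated_countable) (use iso in auto)
  obtain C where C: "\<forall>\<^sub>F n in sequentially. \<forall>y\<in>T.
      measure_pmf.expectation (K y (h n)) (\<lambda>z. (z - y)\<^sup>2) \<le> C * \<bar>h n\<bar>"
    using kernel_second_moment_bigo[OF assms(7,13,14,15)] by blast
  \<comment> \<open>\<open>D * h n\<close> is the error bound of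
    \<open>normalized_estimator_close\<close> for \<open>q = C * h n\<close>.\<close>
  define D where "D = C * (2 * inv_sq_sum + 1) / \<delta>\<^sup>2"
  have "(\<lambda>n. D * h n) \<longlonglongrightarrow> 0"
    by (rule tendsto_mult_right_zero) fact
  then have small: "\<forall>\<^sub>F n in sequentially. D * h n < 1 / 2"
    by (rule order_tendstoD) simp
  \<comment> \<open>The kernel estimates apply to observations in \<open>T\<close> only; the law of
    \<open>X i\<close> is carried by \<open>set_pmf f\<close>, a subset of \<open>T\<close>.\<close>
  have "AE \<omega> in M. X i \<omega> \<in> T" if "i \<in> {1..}" for i
  proof -
    have [measurable]: "random_variable borel (X i)" using rv[of i i] that by simp
    have i: "i \<ge> 1" using that by simp
    have [measurable]: "set_pmf f \<in> sets borel"
      by (rule sets.countable) (simp_all add: countable_set_pmf)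
    have "AE t in distr M borel (X i). t \<in> set_pmf f"
      by (subst distr_eq_distr_pmf[OF \<open>prob_space M\<close> _ assms(5)[OF i]], simp)
         (subst AE_distr_iff, auto simp: AE_measure_pmf)
    then have "AE \<omega> in M. X i \<omega> \<in> set_pmf f"
      by (subst (asm) AE_distr_iff) auto
    then show ?thesis
      by eventually_elim (use assms(3) in auto)
  qed
  then have XT: "AE \<omega> in M. \<forall>i\<in>{1..}. X i \<omega> \<in> T"
    by (intro AE_ball_countable') simp_all
  let ?emp = "\<lambda>n \<omega>. (\<Sum>i=1..n. indicator {x} (X i \<omega>)) / real n :: real"
  \<comment> \<open>The bound is deterministic, and it tends to 0 exactly by the assumption on
    \<open>sqrt (real n) * h n\<close>.\<close>
  have close: "\<forall>\<^sub>F n in sequentially. AE \<omega> in M.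
      \<bar>sqrt (real n) * (normalized_estimator T K h X n x \<omega> - pmf f x) - sqrt (real n) * (?emp n \<omega> - pmf f x)\<bar>
      \<le> 4 * D * (sqrt (real n) * h n)"
    using int C small eventually_ge_at_top[of 1]
  proof eventually_elim
    case (elim n)
    have h: "h n > 0" using elim assms(6) by simp
    have D: "D * h n = C * \<bar>h n\<bar> * (2 * inv_sq_sum + 1) / \<delta>\<^sup>2"
      using h by (simp add: D_def)
    show ?case
      using XT
    proof eventually_elim
      case XT: (elim \<omega>)
      have "\<bar>normalized_estimator T K h X n x \<omega> - ?emp n \<omega>\<bar> \<le> 4 * (D * h n)"
        unfolding D
      proof (rule normalized_estimator_close[OF \<delta>])
        \<comment> \<open>Positivity of \<open>h n\<close> places the support of the kernel inside
          \<open>S y\<close>, where the uniform gap is available.\<close>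
        show "\<delta> \<le> \<bar>z - y\<bar>" if "y \<in> T" "z \<in> set_pmf (K y (h n))" "z \<noteq> y" for y z
          using that assms(10)[OF _ h] by (intro iso) auto
        show "C * \<bar>h n\<bar> * (2 * inv_sq_sum + 1) / \<delta>\<^sup>2 \<le> 1 / 2"
          using elim unfolding D[symmetric] by simp
      qed (use elim XT iso \<open>x \<in> T\<close> in auto)
      then have "sqrt (real n) * \<bar>normalized_estimator T K h X n x \<omega> - ?emp n \<omega>\<bar>
          \<le> sqrt (real n) * (4 * (D * h n))"
        by (rule mult_left_mono) simp
      then show ?case
        by (simp add: abs_mult mult_ac flip: right_diff_distrib)
    qed
  qed
  have ker: "kernel_estimator K h X n y \<in> borel_measurable M" for n y
    unfolding kernel_estimator_def[abs_def]
    by (intro borel_measurable_divide borel_measurable_sum borel_measurable_const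
        measurable_compose[OF rv borel_measurable_pmf])
  \<comment> \<open>Measurability is required for every \<open>n\<close>, also where the sum over
    \<open>T\<close> may diverge.\<close>
  have "normalizing_constant T K h X n \<in> borel_measurable M" for n
    unfolding normalizing_constant_def[abs_def]
    using \<open>countable T\<close> ker
    by (rule borel_measurable_infsum) (simp add: kernel_estimator_def sum_nonneg)
  with ker have [measurable]: "normalized_estimator T K h X n x \<in> borel_measurable M" for n
    unfolding normalized_estimator_def[abs_def] by (intro borel_measurable_divide)
  have [measurable]: "?emp n \<in> borel_measurable M" for n
    by (intro borel_measurable_divide borel_measurable_sum borel_measurable_const
        measurable_compose[OF rv]) auto
  show ?thesis
  proof (rule weak_conv_m_close[OF _ _ _ _ close])
    show "weak_conv_m (\<lambda>n. distr M borel (\<lambda>\<omega>. sqrt (real n) * (?emp n \<omega> - pmf f x)))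
        (normal_law 0 (pmf f x * (1 - pmf f x)))"
      using assms(4,5) by (rule empirical_frequency_clt)
    show "(\<lambda>n. 4 * D * (sqrt (real n) * h n)) \<longlonglongrightarrow> 0"
      by (rule tendsto_mult_right_zero) fact
    show "real_distribution (normal_law 0 (pmf f x * (1 - pmf f x)))"
      by (intro real_distribution_normal_law mult_nonneg_nonneg) (simp_all add: pmf_le_1)
  qed measurable
qed

end
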